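(* Let $p(x)\in\mathbb{R}[x]$ be a polynomial and let $m\ge2$ be an integer. Then the sequence $n\mapsto\lfloor p(n)\rfloor \bmod m$, $n\ge0$, is automatic if and only if it is periodic.
   Context: For an integer $k\ge2$ let $\Sigma_k=\{0,\dots,k-1\}$, let $\Sigma_k^*$ be the set of finite words over $\Sigma_k$ (including the empty word), and let $(n)_k\in\Sigma_k^*$ be the base-$k$ representation of $n\ge0$ without leading zeros ($(0)_k$ is the empty word). A $k$-automaton $(S,s_\bullet,\delta,\Omega,\tau)$ consists of a finite set of states $S$, an initial state $s_\bullet\in S$, a transition map $\delta\colon S\times\Sigma_k\to S$ (extended to $\tilde\delta\colon S\times\Sigma_k^*\to S$ by reading a word letter by letter from left to right), an output set $\Omega$ and an output map $\tau\colon S\to\Omega$. A sequence $(a_n)_{n\ge0}$ with values in a finite set $\Omega$ is $k$-automatic if there is a $k$-automaton with $a_n=\tau(\tilde\delta(s_\bullet,(n)_k))$ for all $n$; it is automatic if it is $k$-automatic for some $k\ge2$. *)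

theory Defs
  imports Complex_Main "HOL-Computational_Algebra.Polynomial"
begin

text \<open>Base-\<open>k\<close> representation, most significant digit first and without leading zeros; \<open>0\<close> is
  represented by the empty word. The guard \<open>k < 2\<close> only serves totality.\<close>

fun base_rep :: "nat \<Rightarrow> nat \<Rightarrow> nat list" where
  "base_rep k n = (if n = 0 \<or> k < 2 then [] else base_rep k (n div k) @ [n mod k])"

declare base_rep.simps [simp del]

record ('s, 'o) automaton =
  states :: "'s set"
  initial :: 's
  trans_map :: "'s \<Rightarrow> nat \<Rightarrow> 's"
  outputs :: "'o set"
  output_map :: "'s \<Rightarrow> 'o"

text \<open>The maps are total HOL functions; only their values on \<open>states A\<close> and on the alphabet
  \<open>{..<k}\<close> are constrained, and only those values matter.\<close>

definition k_automaton :: "nat \<Rightarrow> ('s, 'o) automaton \<Rightarrow> bool" where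
  "k_automaton k A \<longleftrightarrow>
     finite (states A) \<and> initial A \<in> states A \<and>
     (\<forall>s \<in> states A. \<forall>d < k. trans_map A s d \<in> states A) \<and>
     (\<forall>s \<in> states A. output_map A s \<in> outputs A)"

definition run :: "('s, 'o) automaton \<Rightarrow> 's \<Rightarrow> nat list \<Rightarrow> 's" where
  "run A s w = foldl (trans_map A) s w"

definition generates :: "nat \<Rightarrow> ('s, 'o) automaton \<Rightarrow> (nat \<Rightarrow> 'o) \<Rightarrow> bool" where
  "generates k A a \<longleftrightarrow> (\<forall>n. a n = output_map A (run A (initial A) (base_rep k n)))"

text \<open>HOL cannot quantify existentially over the type of states, so states are taken to be natural
  numbers. As state sets are finite this is no restriction: see \<open>k_automaticI\<close> below.\<close>

definition k_automatic :: "nat \<Rightarrow> 'o set \<Rightarrow> (nat \<Rightarrow> 'o) \<Rightarrow> bool" where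
  "k_automatic k \<Omega> a \<longleftrightarrow>
     finite \<Omega> \<and> range a \<subseteq> \<Omega> \<and>
     (\<exists>A :: (nat, 'o) automaton. k_automaton k A \<and> outputs A = \<Omega> \<and> generates k A a)"

definition automatic :: "'o set \<Rightarrow> (nat \<Rightarrow> 'o) \<Rightarrow> bool" where
  "automatic \<Omega> a \<longleftrightarrow> (\<exists>k\<ge>2. k_automatic k \<Omega> a)"

definition periodic :: "(nat \<Rightarrow> 'o) \<Rightarrow> bool" where
  "periodic a \<longleftrightarrow> (\<exists>d>0. \<forall>n. a (n + d) = a n)"

lemma base_rep_0 [simp]: "base_rep k 0 = []"
  by (simp add: base_rep.simps)

lemma base_rep_digit: "d \<in> set (base_rep k n) \<Longrightarrow> d < k"
proof (induction k n rule: base_rep.induct)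
  case (1 k n)
  then show ?case by (subst (asm) base_rep.simps) (auto split: if_splits)
qed

lemma base_rep_hd: "base_rep k n \<noteq> [] \<Longrightarrow> hd (base_rep k n) \<noteq> 0"
proof (induction k n rule: base_rep.induct)
  case (1 k n)
  then have nz: "\<not> (n = 0 \<or> k < 2)" by (metis base_rep.simps)
  then have eq: "base_rep k n = base_rep k (n div k) @ [n mod k]"
    by (subst base_rep.simps) auto
  show ?case
  proof (cases "base_rep k (n div k) = []")
    case True
    then have "n div k = 0" using nz by (subst (asm) base_rep.simps) (auto split: if_splits)
    then show ?thesis using True eq nz by (auto simp: div_eq_0_iff)
  next
    case False
    then show ?thesis using 1 nz eq by auto
  qed
qed

lemma base_rep_value:
  "k \<ge> 2 \<Longrightarrow> foldl (\<lambda>v d. v * k + d) 0 (base_rep k n) = n"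
proof (induction k n rule: base_rep.induct)
  case (1 k n)
  then show ?case by (subst base_rep.simps) auto
qed

lemma k_automaticI:
  fixes A :: "('s, 'o) automaton"
  assumes "finite \<Omega>" "range a \<subseteq> \<Omega>" "k_automaton k A" "outputs A = \<Omega>" "generates k A a"
  shows "k_automatic k \<Omega> a"
proof -
  have fin: "finite (states A)" and ini: "initial A \<in> states A"
    and tr: "\<And>s d. s \<in> states A \<Longrightarrow> d < k \<Longrightarrow> trans_map A s d \<in> states A"
    and out: "\<And>s. s \<in> states A \<Longrightarrow> output_map A s \<in> outputs A"
    using assms(3) by (auto simp: k_automaton_def)
  obtain f :: "'s \<Rightarrow> nat" where f: "inj_on f (states A)"
    using finite_imp_inj_to_nat_seg[OF fin] by auto
  define g where "g = inv_into (states A) f"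
  have gf: "g (f s) = s" if "s \<in> states A" for s
    using f that by (simp add: g_def)
  define B :: "(nat, 'o) automaton" where
    "B = \<lparr> states = f ` states A, initial = f (initial A),
           trans_map = (\<lambda>s d. f (trans_map A (g s) d)), outputs = \<Omega>,
           output_map = (\<lambda>s. output_map A (g s)) \<rparr>"
  have "k_automaton k B"
    using fin ini tr out assms(4) by (auto simp: k_automaton_def B_def gf)
  moreover have run: "run B (f s) w = f (run A s w) \<and> run A s w \<in> states A"
    if "s \<in> states A" "set w \<subseteq> {..<k}" for s w
    using that by (induction w arbitrary: s) (auto simp: run_def B_def gf tr)
  have "generates k B a"
    unfolding generates_def
  proof
    fix n
    have "set (base_rep k n) \<subseteq> {..<k}" using base_rep_digit by blast
    from run[OF ini this] have
      "output_map B (run B (initial B) (base_rep k n)) =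
         output_map A (run A (initial A) (base_rep k n))"
      by (simp add: B_def gf)
    then show "a n = output_map B (run B (initial B) (base_rep k n))"
      using assms(5) by (simp add: generates_def)
  qed
  moreover have "outputs B = \<Omega>" by (simp add: B_def)
  ultimately show ?thesis using assms(1,2) unfolding k_automatic_def by blast
qed

end

theory Submission
  imports Defs "HOL-Analysis.Elementary_Normed_Spaces" "HOL-Analysis.Convex" "HOL-Library.FuncSet"
begin

text \<open>Put \<open>q = p / m\<close>, so that \<open>\<lfloor>p(n)\<rfloor> mod m\<close> depends only on \<open>q(n)\<close> modulo \<open>1\<close> and vanishes iff
  the fractional part of \<open>q(n)\<close> is below \<open>1 / m\<close>. If all nonconstant coefficients of \<open>q\<close> are
  rational, then \<open>q\<close> modulo \<open>1\<close> is periodic. Otherwise, passing to multiples of a suitable \<open>M\<close>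
  removes the rational terms above the highest irrational one and leaves a polynomial \<open>P\<close> with
  irrational leading coefficient. The words of length \<open>t\<close> act on the states of an automaton in
  boundedly many ways, so for large \<open>t\<close> two of them act alike, and the values at \<open>P(K n + i)\<close> and
  \<open>P(K n + j)\<close> agree for all \<open>n\<close>, where \<open>K = k ^ t\<close> and \<open>i \<noteq> j\<close>. But \<open>Q(n) = P(K n + i)\<close> and
  \<open>D(n) = P(K n + j) - P(K n + i)\<close> have irrational leading coefficients and different degrees,
  so by Weyl's theorem \<open>(Q(n), D(n))\<close> is dense modulo \<open>1\<close> (if \<open>D\<close> is constant, it is an
  irrational rotation and the density of \<open>Q(n)\<close> is enough), and some \<open>n\<close> separates the two values.\<close>

section \<open>Weyl sums\<close>

definition mean :: "(nat \<Rightarrow> complex) \<Rightarrow> nat \<Rightarrow> complex" where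
  "mean u N = (\<Sum>n<N. u n) / of_nat N"

lemma mean_sum: "mean (\<lambda>n. \<Sum>i\<in>I. u i n) N = (\<Sum>i\<in>I. mean (u i) N)"
  unfolding mean_def by (subst sum.swap) (simp add: sum_divide_distrib)

lemma mean_cmult: "mean (\<lambda>n. c * u n) N = c * mean u N"
  by (simp add: mean_def sum_distrib_left)

lemma mean_const_LIMSEQ: "mean (\<lambda>n. c) \<longlonglongrightarrow> c"
proof (rule Lim_transform_eventually)
  show "\<forall>\<^sub>F N in sequentially. c = mean (\<lambda>n. c) N"
    using eventually_gt_at_top[of 0] by eventually_elim (simp add: mean_def)
qed simp

lemma norm_mean_le_sum: "norm (mean u N) \<le> (\<Sum>n<N. norm (u n)) / real N"
  unfolding mean_def norm_divide norm_of_nat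
  by (intro divide_right_mono norm_sum) simp

text \<open>Moving the window by one step trades one end term of the sum for another, at a cost of
  at most \<open>2 / N\<close>; this adds up over \<open>h\<close> steps.\<close>

lemma norm_mean_shift_le:
  assumes "\<And>n. norm (u n) \<le> 1"
  shows "norm (mean (\<lambda>n. u (n + h)) N - mean u N) \<le> 2 * real h / real N"
proof (induction h)
  case (Suc h)
  let ?v = "\<lambda>n. u (n + h)"
  have "(\<Sum>n<N. ?v (Suc n)) = (\<Sum>n<N. ?v n) + (?v N - ?v 0)"
    by (induction N) auto
  then have "mean (\<lambda>n. u (n + Suc h)) N - mean ?v N = (?v N - ?v 0) / of_nat N"
    by (simp add: mean_def add_divide_distrib)
  also have "norm \<dots> \<le> 2 / real N"
    unfolding norm_divide norm_of_nat
    using norm_triangle_ineq4[of "?v N" "?v 0"] assms[of "N + h"] assms[of "0 + h"]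
    by (intro divide_right_mono) linarith+
  finally have "norm (mean (\<lambda>n. u (n + Suc h)) N - mean ?v N) \<le> 2 / real N" .
  moreover have "2 * real (Suc h) / real N = 2 / real N + 2 * real h / real N"
    by (simp add: add_divide_distrib)
  ultimately show ?case
    using Suc norm_triangle_ineq[of "mean (\<lambda>n. u (n + Suc h)) N - mean ?v N" "mean ?v N - mean u N"]
    by simp
qed simp

lemma mean_shift_LIMSEQ_0:
  assumes "\<And>n. norm (u n) \<le> 1" "mean u \<longlonglongrightarrow> 0"
  shows "mean (\<lambda>n. u (n + h)) \<longlonglongrightarrow> 0"
proof -
  have "(\<lambda>N. mean (\<lambda>n. u (n + h)) N - mean u N) \<longlonglongrightarrow> 0"
  proof (rule Lim_null_comparison)
    show "\<forall>\<^sub>F N in sequentially. norm (mean (\<lambda>n. u (n + h)) N - mean u N) \<le> 2 * real h / real N"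
      using norm_mean_shift_le[of u h, OF assms(1)] by simp
    show "(\<lambda>N. 2 * real h / real N) \<longlonglongrightarrow> 0"
      by (rule lim_const_over_n)
  qed
  from tendsto_add[OF this assms(2)] show ?thesis by simp
qed

text \<open>Up to \<open>O(1/N)\<close>, the mean of \<open>u\<close> is that of the moving averages of length \<open>H\<close>, whose mean
  square tends to \<open>1/H\<close> because the off-diagonal correlations vanish; then let \<open>H\<close> grow.\<close>

lemma van_der_Corput:
  assumes nrm: "\<And>n. norm (u n) = 1"
    and corr: "\<And>h. h \<ge> 1 \<Longrightarrow> mean (\<lambda>n. u (n + h) * cnj (u n)) \<longlonglongrightarrow> 0"
  shows "mean u \<longlonglongrightarrow> 0"
proof (rule tendstoI)
  fix e :: real assume e: "e > 0"
  \<comment> \<open>The choice makes \<open>2 * H < (H * e / 2)^2\<close>. The mean of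
    \<open>V n * cnj (V n)\<close> tends to \<open>H\<close>, so it is eventually below
    \<open>2 * H\<close> in norm, which forces the mean of \<open>V\<close> below
    \<open>H * e / 2\<close>.\<close>
  obtain H :: nat where H: "8 / e\<^sup>2 < real H" using reals_Archimedean2 by blast
  have H0: "real H > 0" using H e by (smt (verit) zero_less_divide_iff zero_less_power)
  define V where "V n = (\<Sum>h<H. u (n + h))" for n
  \<comment> \<open>For \<open>k < h\<close> this is the correlation of lag \<open>h - k\<close>,
    shifted by \<open>k\<close>; the case \<open>h < k\<close> follows by conjugation.\<close>
  have pair: "mean (\<lambda>n. u (n + h) * cnj (u (n + k))) \<longlonglongrightarrow> (if h = k then 1 else 0)" for h k
  proof -
    have *: "mean (\<lambda>n. u (n + h) * cnj (u (n + k))) \<longlonglongrightarrow> 0" if "k < h" for h k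
    proof -
      have "mean (\<lambda>n. u (n + k + (h - k)) * cnj (u (n + k))) \<longlonglongrightarrow> 0"
        using that by (intro mean_shift_LIMSEQ_0 [of "\<lambda>n. u (n + (h - k)) * cnj (u n)"] corr)
          (auto simp: norm_mult nrm)
      then show ?thesis using that by simp
    qed
    consider "h = k" | "k < h" | "h < k" by linarith
    then show ?thesis
    proof cases
      case 1
      have "u n * cnj (u n) = 1" for n
        using complex_norm_square[of "u n"] by (simp add: nrm)
      with 1 show ?thesis using mean_const_LIMSEQ[of 1] by simp
    next
      case 2
      with * show ?thesis by simp
    next
      case 3
      have "(\<lambda>N. cnj (mean (\<lambda>n. u (n + k) * cnj (u (n + h))) N)) \<longlonglongrightarrow> cnj 0"
        by (intro tendsto_cnj * 3)
      also have "(\<lambda>N. cnj (mean (\<lambda>n. u (n + k) * cnj (u (n + h))) N)) = mean (\<lambda>n. u (n + h) * cnj (u (n + k)))"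
        by (rule ext) (simp add: mean_def mult.commute)
      finally show ?thesis using 3 by simp
    qed
  qed
  have V2: "mean (\<lambda>n. V n * cnj (V n)) \<longlonglongrightarrow> of_nat H"
  proof -
    have "V n * cnj (V n) = (\<Sum>h<H. \<Sum>k<H. u (n + h) * cnj (u (n + k)))" for n
      unfolding V_def cnj_sum sum_product ..
    then have "mean (\<lambda>n. V n * cnj (V n)) =
        (\<lambda>N. \<Sum>h<H. \<Sum>k<H. mean (\<lambda>n. u (n + h) * cnj (u (n + k))) N)"
      by (intro ext) (simp only: mean_sum)
    also have "\<dots> \<longlonglongrightarrow> (\<Sum>h<H. \<Sum>k<H. if h = k then 1 else 0)"
      by (intro tendsto_sum pair)
    finally show ?thesis by simp
  qed
  \<comment> \<open>Cauchy-Schwarz against the constant sequence 1.\<close>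
  have sq: "(norm (mean V N))\<^sup>2 \<le> norm (mean (\<lambda>n. V n * cnj (V n)) N)" for N
  proof (cases "N = 0")
    case False
    have "(norm (mean V N))\<^sup>2 \<le> ((\<Sum>n<N. norm (V n)) / real N)\<^sup>2"
      by (intro power_mono norm_mean_le_sum) simp
    also have "\<dots> \<le> ((\<Sum>n<N. (norm (V n))\<^sup>2) * real N) / (real N)\<^sup>2"
      unfolding power_divide
      using sum_squared_le_sum_of_squares[of "\<lambda>n. norm (V n)" "{..<N}"]
      by (intro divide_right_mono) auto
    also have "\<dots> = (\<Sum>n<N. (norm (V n))\<^sup>2) / real N"
      using False by (simp add: power2_eq_square)
    also have "\<dots> = norm (mean (\<lambda>n. V n * cnj (V n)) N)"
    proof -
      have "mean (\<lambda>n. V n * cnj (V n)) N = of_real ((\<Sum>n<N. (norm (V n))\<^sup>2) / real N)"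
        unfolding mean_def complex_norm_square[symmetric] by simp
      then show ?thesis
        by (simp only: norm_of_real) (simp add: sum_nonneg)
    qed
    finally show ?thesis .
  qed (simp add: mean_def)
  have shift: "norm (mean V N - of_nat H * mean u N) \<le> real H * (2 * real H / real N)" for N
  proof -
    have "mean V N - of_nat H * mean u N = (\<Sum>h<H. mean (\<lambda>n. u (n + h)) N - mean u N)"
      unfolding V_def [abs_def] by (simp add: mean_sum sum_subtractf)
    also have "norm \<dots> \<le> (\<Sum>h<H. 2 * real H / real N)"
    proof (rule sum_norm_le)
      fix h assume "h \<in> {..<H}"
      then have "2 * real h / real N \<le> 2 * real H / real N"
        by (intro divide_right_mono) auto
      then show "norm (mean (\<lambda>n. u (n + h)) N - mean u N) \<le> 2 * real H / real N"
        using norm_mean_shift_le[of u h N] nrm by force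
    qed
    finally show ?thesis by simp
  qed
  have "\<forall>\<^sub>F N in sequentially. 2 * real H / real N < e / 2"
    using order_tendstoD(2)[OF lim_const_over_n[of "2 * real H"], of "e / 2"] e by simp
  moreover have "\<forall>\<^sub>F N in sequentially. norm (mean (\<lambda>n. V n * cnj (V n)) N) < 2 * real H"
    using order_tendstoD(2)[OF tendsto_norm[OF V2], of "2 * real H"] H0 by simp
  ultimately show "\<forall>\<^sub>F N in sequentially. dist (mean u N) 0 < e"
  proof eventually_elim
    case (elim N)
    have "8 < real H * e\<^sup>2" using H e by (simp add: divide_simps)
    then have "2 * real H < (real H * (e / 2))\<^sup>2"
      using H0 by (simp add: power2_eq_square field_simps)
    then have "(norm (mean V N))\<^sup>2 < (real H * (e / 2))\<^sup>2"
      using sq[of N] elim by linarith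
    then have "norm (mean V N) < real H * (e / 2)"
      by (rule power_less_imp_less_base) (use H0 e in simp)
    moreover have "real H * norm (mean u N) \<le> norm (mean V N) + norm (mean V N - of_nat H * mean u N)"
      using norm_triangle_ineq4[of "mean V N" "mean V N - of_nat H * mean u N"]
      by (simp add: norm_mult)
    moreover have "real H * (2 * real H / real N) < real H * (e / 2)"
      using elim(1) H0 by (rule mult_strict_left_mono)
    ultimately have "real H * norm (mean u N) < real H * (e / 2) + real H * (e / 2)"
      using shift[of N] by linarith
    then have "real H * norm (mean u N) < real H * e" by (simp add: field_simps)
    then show ?case using H0 by simp
  qed
qed

text \<open>Induction along Horner's scheme: shifting \<open>pCons a R\<close> gives
  \<open>a + (x + b) * R(x + b)\<close>, so its two top coefficients come from those of the shifted
  \<open>R\<close>.\<close>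

lemma coeff_pcompose_shift:
  fixes P :: "'a::idom poly"
  assumes "degree P \<le> Suc e"
  shows "coeff (pcompose P [:b, 1:]) (Suc e) = coeff P (Suc e)"
    and "coeff (pcompose P [:b, 1:]) e = coeff P e + of_nat (Suc e) * b * coeff P (Suc e)"
proof -
  have "coeff (pcompose P [:b, 1:]) (Suc e) = coeff P (Suc e) \<and>
    coeff (pcompose P [:b, 1:]) e = coeff P e + of_nat (Suc e) * b * coeff P (Suc e)"
    using assms
  proof (induction P arbitrary: e)
    case (pCons a R)
    have R: "degree R \<le> e"
      using pCons.prems by (cases "R = 0") auto
    show ?case
    proof (cases e)
      case 0
      then obtain c where "R = [:c:]" using R degree_eq_zeroE by blast
      with 0 show ?thesis by (simp add: pcompose_pCons)
    next
      case (Suc f)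
      have "degree (pcompose R [:b, 1:]) \<le> e"
        using R by (simp add: degree_pcompose)
      then have "coeff (pcompose R [:b, 1:]) (Suc e) = 0" "coeff R (Suc e) = 0"
        using R by (auto intro: coeff_eq_0)
      then show ?thesis
        using pCons.IH[of f] R Suc by (simp add: pcompose_pCons algebra_simps)
    qed
  qed simp
  then show "coeff (pcompose P [:b, 1:]) (Suc e) = coeff P (Suc e)"
    "coeff (pcompose P [:b, 1:]) e = coeff P e + of_nat (Suc e) * b * coeff P (Suc e)" by auto
qed

text \<open>Differencing cancels the leading term. The degree is only bounded from above because
  \<open>b\<close> may be 0. For rational \<open>b \<noteq> 0\<close> an irrational leading
  coefficient stays irrational, and equality follows.\<close>

lemma poly_shift_diff:
  fixes P :: "'a::{idom,ring_char_0} poly" and b :: 'a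
  assumes "degree P = Suc e"
  defines "D \<equiv> pcompose P [:b, 1:] - P"
  shows "degree D \<le> e" and "coeff D e = of_nat (Suc e) * b * lead_coeff P"
proof -
  note c = coeff_pcompose_shift[of P e b]
  show "coeff D e = of_nat (Suc e) * b * lead_coeff P"
    using assms c by simp
  show "degree D \<le> e"
  proof (rule degree_le, intro allI impI)
    fix i assume i: "e < i"
    have "degree (pcompose P [:b, 1:]) = Suc e"
      using assms by (simp add: degree_pcompose)
    then show "coeff D i = 0"
      using i c assms by (cases "i = Suc e") (auto simp: coeff_eq_0)
  qed
qed

lemma irrational_mult:
  fixes x y :: real
  assumes "x \<in> \<rat>" "x \<noteq> 0" "y \<notin> \<rat>"
  shows "x * y \<notin> \<rat>"
proof
  assume "x * y \<in> \<rat>"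
  then have "x * y / x \<in> \<rat>" using assms(1) by (rule Rats_divide)
  with assms show False by simp
qed

lemma cis_2pi_irrational:
  assumes "\<alpha> \<notin> \<rat>"
  shows "cis (2 * pi * \<alpha>) \<noteq> 1"
proof
  assume "cis (2 * pi * \<alpha>) = 1"
  then have "cos (2 * pi * \<alpha>) = 1"
    by (metis cis.sel(1) one_complex.sel(1))
  then obtain n :: int where "2 * pi * \<alpha> = of_int n * (2 * pi)"
    by (auto simp: cos_one_2pi_int)
  then have "\<alpha> = of_int n" by simp
  with assms show False by simp
qed

text \<open>For degree 1 the sum is geometric with ratio \<open>z \<noteq> 1\<close>, hence bounded.
  For higher degree the correlations of lag \<open>h\<close> are exponentials of
  \<open>P(n + h) - P(n)\<close>, whose degree is one less and whose leading coefficient is still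
  irrational, so van der Corput's inequality drives the induction.\<close>

theorem Weyl_mean:
  fixes P :: "real poly"
  assumes "degree P \<ge> 1" "lead_coeff P \<notin> \<rat>"
  shows "mean (\<lambda>n. cis (2 * pi * poly P (real n))) \<longlonglongrightarrow> 0"
  using assms
proof (induction "degree P" arbitrary: P)
  case (Suc e)
  show ?case
  proof (cases "e = 0")
    case True
    then obtain a b where P: "P = [:b, a:]"
      using degree1_coeffs[of P] Suc.hyps(2) by (metis One_nat_def)
    with Suc.prems have a: "a \<notin> \<rat>" by (auto split: if_splits)
    define z where "z = cis (2 * pi * a)"
    have z: "z \<noteq> 1" "norm z = 1" using cis_2pi_irrational[OF a] by (auto simp: z_def)
    have eq: "cis (2 * pi * poly P (real n)) = cis (2 * pi * b) * z ^ n" for n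
      by (simp add: P z_def DeMoivre cis_mult algebra_simps)
    have "norm (mean (\<lambda>n. cis (2 * pi * poly P (real n))) N) \<le> (2 / norm (z - 1)) / real N" for N
    proof -
      have "norm (z ^ N - 1) \<le> 2"
        using norm_triangle_ineq4[of "z ^ N" 1] by (simp add: norm_power z)
      then have "norm (\<Sum>n<N. z ^ n) \<le> 2 / norm (z - 1)"
        using z by (simp add: geometric_sum norm_divide divide_right_mono)
      then have "norm (\<Sum>n<N. z ^ n) / real N \<le> (2 / norm (z - 1)) / real N"
        by (rule divide_right_mono) simp
      then show ?thesis
        unfolding eq mean_cmult by (simp only: mean_def norm_mult norm_divide norm_cis) simp
    qed
    then show ?thesis
      by (intro Lim_null_comparison[OF _ lim_const_over_n] always_eventually allI)
  next
    case False
    show ?thesis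
    proof (rule van_der_Corput)
      fix h :: nat assume h: "h \<ge> 1"
      define D where "D = pcompose P [:real h, 1:] - P"
      note D = poly_shift_diff[OF Suc.hyps(2)[symmetric], of "real h", folded D_def]
      have irr: "coeff D e \<notin> \<rat>"
        unfolding D(2) using Suc.prems h by (intro irrational_mult) auto
      then have "coeff D e \<noteq> 0" by auto
      then have deg: "degree D = e" using D(1) le_degree[of D e] by simp
      have "mean (\<lambda>n. cis (2 * pi * poly D (real n))) \<longlonglongrightarrow> 0"
        using False irr deg by (intro Suc.hyps(1)) auto
      moreover have "cis (2 * pi * poly D (real n)) =
          cis (2 * pi * poly P (real (n + h))) * cnj (cis (2 * pi * poly P (real n)))" for n
        by (simp add: D_def poly_pcompose cis_cnj cis_mult algebra_simps)
      ultimately show "mean (\<lambda>n. cis (2 * pi * poly P (real (n + h))) *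
          cnj (cis (2 * pi * poly P (real n)))) \<longlonglongrightarrow> 0" by simp
    qed simp
  qed
qed simp

section \<open>Density modulo 1\<close>

text \<open>The cosine of \<open>2 * pi * x\<close> is a decreasing function of the distance from
  \<open>x\<close> to the nearest integer, which lies in \<open>[0, 1/2]\<close>.\<close>

lemma near_int_of_cos:
  fixes x \<delta> :: real
  assumes "cos (2 * pi * x) > cos (2 * pi * \<delta>)" "0 \<le> \<delta>" "\<delta> \<le> 1 / 2"
  shows "\<exists>k::int. \<bar>x - of_int k\<bar> < \<delta>"
proof (rule exI, rule ccontr)
  let ?d = "\<bar>x - of_int (round x)\<bar>"
  assume "\<not> ?d < \<delta>"
  moreover have "?d \<le> 1 / 2"
    using of_int_round_abs_le[of x] by (simp add: abs_minus_commute)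
  ultimately have "cos (2 * pi * ?d) \<le> cos (2 * pi * \<delta>)"
    using assms(2,3) by (intro cos_monotone_0_pi_le) auto
  moreover have "cos (2 * pi * ?d) = cos (2 * pi * x)"
  proof -
    have "cos (2 * pi * ?d) = cos \<bar>2 * pi * (x - of_int (round x))\<bar>"
      by (simp add: abs_mult)
    also have "\<dots> = cos (2 * pi * x - 2 * pi * of_int (round x))"
      by (simp add: algebra_simps)
    also have "\<dots> = cos (2 * pi * x)"
      by (simp add: cos_diff)
    finally show ?thesis .
  qed
  ultimately show False using assms(1) by simp
qed

lemma cos_kernel_bounds:
  fixes t :: real
  shows "0 \<le> (1 + cos t) / 2" "(1 + cos t) / 2 \<le> 1"
proof -
  have "0 \<le> (1 + x) / 2" "(1 - x) / 2 \<le> 1" if "-1 \<le> x" for x :: real using that by auto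
  from this(1)[of "cos t"] this(2)[of "- cos t"]
  show "0 \<le> (1 + cos t) / 2" "(1 + cos t) / 2 \<le> 1" by simp_all
qed

text \<open>Fourier expansion of the kernel: raise
  \<open>(1 + cos t) / 2 = cis (- t) * (1 + cis t)^2 / 4\<close> to the power \<open>K\<close> and
  apply the binomial theorem. Frequency 0 occurs at \<open>j = K\<close>, with the central binomial
  coefficient.\<close>

lemma cos_kernel_expansion:
  "complex_of_real (((1 + cos t) / 2) ^ K) =
     (\<Sum>j\<le>2 * K. of_real (real (2 * K choose j) / 4 ^ K) * cis ((real j - real K) * t))"
proof -
  have "complex_of_real ((1 + cos t) / 2) = cis (- t) * (1 + cis t)\<^sup>2 / 4"
  proof -
    have "cis (- t) * (1 + cis t)\<^sup>2 = cis (- t) + 2 * (cis (- t) * cis t) + cis (- t) * cis t * cis t"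
      by (simp add: power2_eq_square algebra_simps)
    also have "\<dots> = cis (- t) + 2 + cis t" by (simp add: cis_mult)
    finally show ?thesis by (simp add: complex_eq_iff)
  qed
  then have "complex_of_real (((1 + cos t) / 2) ^ K) = (cis (- t) * (1 + cis t)\<^sup>2 / 4) ^ K"
    by (simp only: of_real_power)
  also have "\<dots> = cis (- t) ^ K * (cis t + 1) ^ (2 * K) / 4 ^ K"
    by (simp add: power_mult_distrib power_divide power_mult add.commute)
  also have "\<dots> = (\<Sum>j\<le>2 * K. of_real (real (2 * K choose j) / 4 ^ K) * (cis (- t) ^ K * cis t ^ j))"
    unfolding binomial_ring by (simp add: sum_distrib_left sum_divide_distrib mult_ac)
  also have "\<dots> = (\<Sum>j\<le>2 * K. of_real (real (2 * K choose j) / 4 ^ K) * cis ((real j - real K) * t))"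
    by (simp add: DeMoivre cis_mult algebra_simps)
  finally show ?thesis .
qed

text \<open>Every nontrivial frequency pair \<open>(u, v)\<close> thus meets the hypotheses of
  Weyl's theorem: if \<open>v \<noteq> 0\<close>, the term of higher degree decides, otherwise
  \<open>u * A\<close> is all there is.\<close>

lemma irrational_lincomb:
  fixes A B :: "real poly" and u v :: int
  assumes A: "degree A \<ge> 1" "lead_coeff A \<notin> \<rat>" and B: "lead_coeff B \<notin> \<rat>"
    and lt: "degree A < degree B" and uv: "u \<noteq> 0 \<or> v \<noteq> 0"
  defines "R \<equiv> smult (of_int u) A + smult (of_int v) B"
  shows "degree R \<ge> 1" "lead_coeff R \<notin> \<rat>"
proof -
  have "degree R \<ge> 1 \<and> lead_coeff R \<notin> \<rat>"
  proof (cases "v = 0")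
    case True
    with uv A irrational_mult[of "of_int u" "lead_coeff A"] show ?thesis by (auto simp: R_def)
  next
    case False
    then have l: "degree (smult (of_int u) A) < degree (smult (of_int v) B)"
      using lt degree_smult_le[of "of_int u" A] by simp
    then have "degree R = degree B" "lead_coeff R = of_int v * lead_coeff B"
      using False unfolding R_def by (simp_all only: degree_add_eq_right lead_coeff_add_le)
        (use lt coeff_eq_0[of A "degree B"] in simp_all)
    then show ?thesis using A(1) B lt False irrational_mult[of "of_int v" "lead_coeff B"] by auto
  qed
  then show "degree R \<ge> 1" "lead_coeff R \<notin> \<rat>" by auto
qed

text \<open>The kernel \<open>((1 + cos \<theta>) / 2) ^ K * ((1 + cos \<phi>) / 2) ^ K\<close> has mean
  \<open>((2 K choose K) / 4 ^ K)\<^sup>2\<close> along the two polynomials, which decays only polynomially in \<open>K\<close>,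
  but it would be exponentially small if a neighbourhood of \<open>(x, y)\<close> were avoided.\<close>

theorem poly_pair_dense_mod_1:
  fixes A B :: "real poly" and x y \<delta> :: real
  assumes A: "degree A \<ge> 1" "lead_coeff A \<notin> \<rat>" and B: "lead_coeff B \<notin> \<rat>"
    and lt: "degree A < degree B" and \<delta>: "0 < \<delta>"
  shows "\<exists>n (k::int) (l::int). \<bar>poly A (real n) - x - of_int k\<bar> < \<delta> \<and>
                            \<bar>poly B (real n) - y - of_int l\<bar> < \<delta>"
proof (rule ccontr)
  assume contra: "\<not> ?thesis"
  define \<epsilon> where "\<epsilon> = min \<delta> (1 / 2)"
  have \<epsilon>: "0 < \<epsilon>" "\<epsilon> \<le> 1 / 2" "\<epsilon> \<le> \<delta>" using \<delta> by (auto simp: \<epsilon>_def)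
  define \<theta> where "\<theta> n = 2 * pi * (poly A (real n) - x)" for n :: nat
  define \<phi> where "\<phi> n = 2 * pi * (poly B (real n) - y)" for n :: nat
  define c where "c = (1 + cos (2 * pi * \<epsilon>)) / 2"
  have c: "0 \<le> c" "c < 1"
  proof -
    show "0 \<le> c" unfolding c_def by (rule cos_kernel_bounds)
    show "c < 1" using cos_monotone_0_pi[of 0 "2 * pi * \<epsilon>"] \<epsilon> by (simp add: c_def)
  qed
  have gap: "cos (\<theta> n) \<le> cos (2 * pi * \<epsilon>) \<or> cos (\<phi> n) \<le> cos (2 * pi * \<epsilon>)" for n
  proof (rule ccontr)
    assume "\<not> ?thesis"
    then obtain k l :: int where "\<bar>poly A (real n) - x - of_int k\<bar> < \<epsilon>" "\<bar>poly B (real n) - y - of_int l\<bar> < \<epsilon>"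
      using near_int_of_cos[of \<epsilon>] \<epsilon> unfolding \<theta>_def \<phi>_def not_le de_Morgan_disj by (metis less_imp_le)
    with contra \<epsilon> show False by (meson less_le_trans)
  qed
  \<comment> \<open>The means of \<open>f\<close> tend to the square of the central coefficient
    \<open>a K\<close>, while \<open>f\<close> is at most \<open>c ^ K\<close> pointwise. So
    \<open>a K\<close> is at most \<open>sqrt c ^ K\<close>, but it is at least
    \<open>1 / (2 * K)\<close>; as \<open>c < 1\<close>, this fails for large
    \<open>K\<close>.\<close>
  have bound: "1 / 2 \<le> real K * sqrt c ^ K" if K: "K \<ge> 1" for K
  proof -
    define a where "a j = real (2 * K choose j) / 4 ^ K" for j
    define f where "f n = ((1 + cos (\<theta> n)) / 2) ^ K * ((1 + cos (\<phi> n)) / 2) ^ K" for n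
    have f_bound: "0 \<le> f n \<and> f n \<le> c ^ K" for n
    proof -
      note * = cos_kernel_bounds
      have "((1 + cos (\<theta> n)) / 2) * ((1 + cos (\<phi> n)) / 2) \<le> c"
        using gap[of n]
      proof
        assume "cos (\<theta> n) \<le> cos (2 * pi * \<epsilon>)"
        then have "((1 + cos (\<theta> n)) / 2) * ((1 + cos (\<phi> n)) / 2) \<le> c * 1"
          using *[of "\<phi> n"] c by (intro mult_mono) (auto simp: c_def)
        then show ?thesis by simp
      next
        assume "cos (\<phi> n) \<le> cos (2 * pi * \<epsilon>)"
        then have "((1 + cos (\<theta> n)) / 2) * ((1 + cos (\<phi> n)) / 2) \<le> 1 * c"
          using *[of "\<theta> n"] *[of "\<phi> n"] c by (intro mult_mono) (auto simp: c_def)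
        then show ?thesis by simp
      qed
      then show ?thesis
        using *[of "\<theta> n"] *[of "\<phi> n"]
        unfolding f_def power_mult_distrib[symmetric] by (intro conjI power_mono zero_le_power mult_nonneg_nonneg) auto
    qed
    have coeff_mean: "mean (\<lambda>n. cis ((real j - real K) * \<theta> n) * cis ((real k - real K) * \<phi> n))
        \<longlonglongrightarrow> (if j = K \<and> k = K then 1 else 0)" for j k
    proof (cases "j = K \<and> k = K")
      case True
      then show ?thesis using mean_const_LIMSEQ[of 1] by simp
    next
      case False
      define u v where "u = int j - int K" and "v = int k - int K"
      define R where "R = smult (of_int u) A + smult (of_int v) B"
      \<comment> \<open>The constant phase contributed by the target point
        \<open>(x, y)\<close>.\<close>
      define z where "z = cis (- (2 * pi * (of_int u * x + of_int v * y)))"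
      have "u \<noteq> 0 \<or> v \<noteq> 0" using False by (auto simp: u_def v_def)
      then have "mean (\<lambda>n. cis (2 * pi * poly R (real n))) \<longlonglongrightarrow> 0"
        unfolding R_def by (intro Weyl_mean irrational_lincomb A B lt)
      then have "mean (\<lambda>n. z * cis (2 * pi * poly R (real n))) \<longlonglongrightarrow> z * 0"
        unfolding mean_cmult by (intro tendsto_mult tendsto_const)
      moreover have "cis ((real j - real K) * \<theta> n) * cis ((real k - real K) * \<phi> n) =
          z * cis (2 * pi * poly R (real n))" for n
        unfolding z_def cis_mult
        by (rule arg_cong[of _ _ cis]) (simp add: R_def u_def v_def \<theta>_def \<phi>_def algebra_simps)
      ultimately show ?thesis by (simp only: False if_False mult_zero_right)
    qed
    have "mean (\<lambda>n. of_real (f n)) \<longlonglongrightarrow> of_real ((a K)\<^sup>2)"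
    proof -
      have "of_real (f n) = (\<Sum>j\<le>2 * K. \<Sum>k\<le>2 * K. complex_of_real (a j * a k) *
          (cis ((real j - real K) * \<theta> n) * cis ((real k - real K) * \<phi> n)))" for n
        unfolding f_def of_real_mult[of "_ ^ K"] cos_kernel_expansion sum_product
        by (intro sum.cong refl) (simp add: a_def mult_ac)
      then have "mean (\<lambda>n. of_real (f n)) = (\<lambda>N. \<Sum>j\<le>2 * K. \<Sum>k\<le>2 * K. complex_of_real (a j * a k) *
          mean (\<lambda>n. cis ((real j - real K) * \<theta> n) * cis ((real k - real K) * \<phi> n)) N)"
        by (intro ext) (simp only: mean_sum mean_cmult)
      also have "\<dots> \<longlonglongrightarrow> (\<Sum>j\<le>2 * K. \<Sum>k\<le>2 * K. complex_of_real (a j * a k) * (if j = K \<and> k = K then 1 else 0))"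
        by (intro tendsto_sum tendsto_mult tendsto_const coeff_mean)
      also have "(\<Sum>j\<le>2 * K. \<Sum>k\<le>2 * K. complex_of_real (a j * a k) * (if j = K \<and> k = K then 1 else 0)) =
          (\<Sum>j\<le>2 * K. if j = K then complex_of_real (a K * a K) else 0)"
      proof (intro sum.cong refl)
        fix j
        show "(\<Sum>k\<le>2 * K. complex_of_real (a j * a k) * (if j = K \<and> k = K then 1 else 0)) =
            (if j = K then complex_of_real (a K * a K) else 0)"
          by (cases "j = K") (simp_all add: if_distrib cong: if_cong)
      qed
      also have "\<dots> = of_real ((a K)\<^sup>2)" by (simp add: power2_eq_square)
      finally show ?thesis .
    qed
    then have "(\<lambda>N. norm (mean (\<lambda>n. of_real (f n)) N)) \<longlonglongrightarrow> norm (complex_of_real ((a K)\<^sup>2))"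
      by (rule tendsto_norm)
    moreover have "norm (mean (\<lambda>n. of_real (f n)) N) \<le> c ^ K" for N
    proof -
      have "(\<Sum>n<N. norm (complex_of_real (f n))) \<le> (\<Sum>n<N. c ^ K)"
        using f_bound by (intro sum_mono) auto
      then have "(\<Sum>n<N. norm (complex_of_real (f n))) / real N \<le> real N * c ^ K / real N"
        by (intro divide_right_mono) auto
      also have "\<dots> \<le> c ^ K" using c by (cases "N = 0") auto
      finally show ?thesis using norm_mean_le_sum[of "\<lambda>n. of_real (f n)" N] by linarith
    qed
    ultimately have "norm (complex_of_real ((a K)\<^sup>2)) \<le> c ^ K"
      using LIMSEQ_le_const2 by blast
    moreover have "(sqrt c ^ K)\<^sup>2 = c ^ K"
      using c by (metis mult.commute power_mult real_sqrt_pow2)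
    ultimately have "(a K)\<^sup>2 \<le> (sqrt c ^ K)\<^sup>2"
      by (simp only: norm_of_real abs_power2)
    then have "a K \<le> sqrt c ^ K"
      by (rule power2_le_imp_le) (use c in simp)
    moreover have "1 / (2 * real K) \<le> a K"
      using central_binomial_lower_bound[of K] K by (simp add: a_def divide_simps mult_ac)
    ultimately have "real K * (1 / (2 * real K)) \<le> real K * sqrt c ^ K"
      by (intro mult_left_mono) auto
    then show ?thesis using K by simp
  qed
  have "norm (sqrt c) < 1" using c by simp
  then have "(\<lambda>K. real K * sqrt c ^ K) \<longlonglongrightarrow> 0"
    by (rule powser_times_n_limit_0)
  then have "1 / 2 \<le> (0 :: real)"
    using bound LIMSEQ_le_const by blast
  then show False by simp
qed

section \<open>Rational polynomials and collisions in automata\<close>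

lemma poly_common_denominator:
  fixes P :: "real poly"
  assumes "\<And>i. coeff P i \<in> \<rat>"
  shows "\<exists>M\<ge>1::nat. \<forall>i. real M * coeff P i \<in> \<int>"
  using assms
proof (induction P)
  case (pCons a R)
  have "coeff R i \<in> \<rat>" for i using pCons.prems[of "Suc i"] by simp
  with pCons.IH obtain M where M: "M \<ge> 1" "\<And>i. real M * coeff R i \<in> \<int>" by blast
  have "a \<in> \<rat>" using pCons.prems[of 0] by simp
  then obtain b d :: int where d: "d > 0" "a = of_int b / of_int d"
    by (auto elim: Rats_cases')
  have "real (nat d * M) * coeff (pCons a R) i \<in> \<int>" for i
  proof (cases i)
    case 0
    then have "real (nat d * M) * coeff (pCons a R) i = of_int (b * int M)"
      using d by simp
    then show ?thesis by (metis Ints_of_int)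
  next
    case (Suc i')
    have "of_int d * (real M * coeff R i') \<in> \<int>" by (rule Ints_mult[OF Ints_of_int M(2)])
    moreover have "real (nat d * M) * coeff (pCons a R) i = of_int d * (real M * coeff R i')"
      using Suc d by simp
    ultimately show ?thesis by metis
  qed
  moreover have "nat d * M \<ge> 1" using M d by (simp add: Suc_le_eq)
  ultimately show ?case by blast
qed auto

text \<open>The congruence of values at arguments congruent modulo \<open>M\<close>, phrased in the
  reals because \<open>S\<close> is a real polynomial.\<close>

lemma int_poly_shift:
  fixes S :: "real poly" and x M :: int
  assumes "\<And>i. coeff S i \<in> \<int>"
  shows "\<exists>z::int. poly S (of_int x + of_int M) = poly S (of_int x) + of_int (M * z)"
  using assms
proof (induction S)
  case (pCons a R)
  have R: "coeff R i \<in> \<int>" for i using pCons.prems[of "Suc i"] by simp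
  with pCons.IH obtain z where z: "poly R (of_int x + of_int M) = poly R (of_int x) + of_int (M * z)"
    by blast
  have "poly R (of_int x + of_int M) \<in> \<int>"
    unfolding poly_altdef using R by (intro Ints_sum Ints_mult Ints_power) auto
  then obtain w :: int where w: "poly R (of_int x + of_int M) = of_int w" by (auto elim: Ints_cases)
  have "poly (pCons a R) (of_int x + of_int M) = poly (pCons a R) (of_int x) + of_int (M * (x * z + w))"
  proof -
    have "poly (pCons a R) (of_int x + of_int M) =
        a + of_int x * poly R (of_int x + of_int M) + of_int M * poly R (of_int x + of_int M)"
      by (simp add: algebra_simps)
    also have "\<dots> = a + of_int x * (poly R (of_int x) + of_int (M * z)) + of_int M * of_int w"
      by (metis w z)
    finally show ?thesis by (simp add: algebra_simps)
  qed
  then show ?case by blast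
qed (auto intro: exI[of _ 0])

text \<open>With \<open>M\<close> a common denominator, the values of \<open>M * P\<close> at
  \<open>n + M\<close> and \<open>n\<close> differ by a multiple of \<open>M\<close>; divide by
  \<open>M\<close>.\<close>

lemma rational_poly_periodic_mod_1:
  fixes P :: "real poly"
  assumes "\<And>i. coeff P i \<in> \<rat>"
  shows "\<exists>M\<ge>1::nat. \<forall>n. \<exists>z::int. poly P (real (n + M)) = poly P (real n) + of_int z"
proof -
  obtain M where M: "M \<ge> 1" "\<And>i. real M * coeff P i \<in> \<int>"
    using poly_common_denominator assms by blast
  have "\<exists>z::int. poly P (real (n + M)) = poly P (real n) + of_int z" for n
    using int_poly_shift[of "smult (real M) P" "int n" "int M"] M
    by (auto simp: distrib_left[symmetric])
  with M show ?thesis by blast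
qed

lemma floor_mod_eq_0:
  fixes y :: real and m z :: int
  assumes "m > 0" "of_int z \<le> y" "y < of_int z + 1 / of_int m"
  shows "\<lfloor>of_int m * y\<rfloor> mod m = 0"
proof -
  have "\<lfloor>of_int m * y\<rfloor> = m * z"
    using assms by (intro floor_unique) (auto simp: field_simps)
  then show ?thesis by simp
qed

lemma floor_mod_neq_0:
  fixes y :: real and m z :: int
  assumes "m > 0" "of_int z + 1 / of_int m \<le> y" "y < of_int z + 1"
  shows "\<lfloor>of_int m * y\<rfloor> mod m \<noteq> 0"
proof -
  define w where "w = \<lfloor>of_int m * (y - of_int z)\<rfloor>"
  have "\<lfloor>of_int m * y\<rfloor> = \<lfloor>of_int m * (y - of_int z) + of_int (m * z)\<rfloor>"
    by (simp add: algebra_simps)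
  also have "\<dots> = w + m * z" unfolding w_def by (rule floor_add_int[symmetric])
  finally have "\<lfloor>of_int m * y\<rfloor> mod m = w mod m" by simp
  moreover have "1 \<le> of_int m * (y - of_int z)" "of_int m * (y - of_int z) < of_int m * 1"
    using assms by (simp add: field_simps, intro mult_strict_left_mono) auto
  then have "1 \<le> w" "w < m" unfolding w_def by (auto simp: le_floor_iff floor_less_iff)
  ultimately show ?thesis by simp
qed

section \<open>Digit words of fixed length and their action on states\<close>

fun low_digits :: "nat \<Rightarrow> nat \<Rightarrow> nat \<Rightarrow> nat list" where
  "low_digits k 0 r = []"
| "low_digits k (Suc t) r = low_digits k t (r div k) @ [r mod k]"

lemma set_low_digits: "k > 0 \<Longrightarrow> set (low_digits k t r) \<subseteq> {..<k}"
  by (induction t arbitrary: r) auto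

text \<open>For \<open>n = 0\<close> the zeros that pad \<open>low_digits\<close> would be leading
  zeros, which \<open>base_rep\<close> omits; hence \<open>n \<ge> 1\<close>.\<close>

lemma base_rep_append:
  assumes "k \<ge> 2" "n \<ge> 1" "r < k ^ t"
  shows "base_rep k (k ^ t * n + r) = base_rep k n @ low_digits k t r"
  using assms(3)
proof (induction t arbitrary: r)
  case (Suc t)
  let ?N = "k ^ Suc t * n + r"
  have eq: "?N = r + k * (k ^ t * n)" by simp
  have "?N div k = k ^ t * n + r div k" "?N mod k = r mod k"
    unfolding eq using assms(1) by simp_all
  moreover have "r div k < k ^ t"
    using Suc.prems by (intro less_mult_imp_div_less) (simp add: mult.commute)
  moreover have "?N > 0" using assms(1,2) by simp
  then have "base_rep k ?N = base_rep k (?N div k) @ [?N mod k]"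
    using assms(1) by (subst base_rep.simps) auto
  ultimately show ?case using Suc.IH[of "r div k"] by simp
qed simp

lemma run_in_states:
  assumes "k_automaton k A" "s \<in> states A" "set w \<subseteq> {..<k}"
  shows "run A s w \<in> states A"
  using assms(2,3)
  by (induction w arbitrary: s) (use assms(1) in \<open>auto simp: run_def k_automaton_def\<close>)

lemma k_automatic_collision:
  assumes "k \<ge> 2" "k_automatic k \<Omega> a" "M \<ge> 1"
  shows "\<exists>K\<ge>1. \<exists>i j. i < j \<and> (\<forall>n. a (M * (K * n + i)) = a (M * (K * n + j)))"
proof -
  obtain A :: "(nat, 'a) automaton" where A: "k_automaton k A" and gen: "generates k A a"
    using assms(2) by (auto simp: k_automatic_def)
  define F where "F = states A \<rightarrow>\<^sub>E states A"
  have F: "finite F"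
    unfolding F_def using A by (intro finite_PiE) (auto simp: k_automaton_def)
  \<comment> \<open>Long enough that all \<open>M * l\<close> with \<open>l \<le> card F\<close>
    have at most \<open>t\<close> digits, since \<open>M * l < t < k ^ t\<close>.\<close>
  define t where "t = M * Suc (card F)"
  \<comment> \<open>The restriction makes \<open>g i\<close> an element of the finite set
    \<open>F\<close>; there are \<open>card F + 1\<close> indices, so two of these maps
    coincide.\<close>
  define g where "g i = restrict (\<lambda>s. run A s (low_digits k t (M * i))) (states A)" for i
  have "g ` {..card F} \<subseteq> F"
    using run_in_states[OF A] set_low_digits[of k] assms(1) by (auto simp: g_def F_def)
  then have "card (g ` {..card F}) < card {..card F}"
    using card_mono[OF F] by (auto simp: less_Suc_eq_le)
  then obtain i j where ij: "i < j" "j \<le> card F" "g i = g j"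
    using pigeonhole[of g "{..card F}"] by (auto simp: inj_on_def) (metis linorder_neqE_nat)
  have t: "t < k ^ t" using assms(1) by (simp add: power_gt_expt)
  have small: "M * l < k ^ t" if "l \<le> card F" for l
  proof -
    have "M * l < t" unfolding t_def using that assms(3) by (intro mult_strict_left_mono) auto
    with t show ?thesis by linarith
  qed
  have val: "a (k ^ t * n + M * l) = output_map A (g l (run A (initial A) (base_rep k n)))"
    if "n \<ge> 1" "l \<le> card F" for n l
  proof -
    have "run A (initial A) (base_rep k n) \<in> states A"
      using A base_rep_digit by (intro run_in_states[OF A]) (auto simp: k_automaton_def)
    then show ?thesis
      using gen base_rep_append[OF assms(1) that(1) small[OF that(2)]]
      by (simp add: generates_def run_def g_def)
  qed
  \<comment> \<open>\<open>val\<close> needs a nonzero prefix, so the prefix is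
    \<open>M * Suc n\<close>; this shifts both \<open>i\<close> and \<open>j\<close> by
    \<open>k ^ t\<close>.\<close>
  have "a (M * (k ^ t * n + (k ^ t + i))) = a (M * (k ^ t * n + (k ^ t + j)))" for n
  proof -
    have "a (k ^ t * (M * Suc n) + M * i) = a (k ^ t * (M * Suc n) + M * j)"
      using val[of "M * Suc n"] ij assms(3) by simp
    then show ?thesis by (simp add: algebra_simps)
  qed
  moreover have "k ^ t \<ge> 1" using assms(1) by simp
  ultimately show ?thesis using ij(1) by (meson nat_add_left_cancel_less)
qed

text \<open>Horner's rule modulo \<open>d\<close>: after reading a prefix in base 2, the state is
  its value modulo \<open>d\<close>.\<close>

lemma periodic_imp_automatic:
  assumes "finite \<Omega>" "range a \<subseteq> \<Omega>" "periodic a"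
  shows "automatic \<Omega> a"
proof -
  obtain d where d: "d > 0" "\<And>n. a (n + d) = a n" using assms(3) by (auto simp: periodic_def)
  have "a (n + q * d) = a n" for n q
    by (induction q) (simp_all add: d(2) add.assoc[symmetric] add.commute[of d])
  from this[of "n mod d" "n div d" for n] have a_mod: "a (n mod d) = a n" for n by simp
  define A :: "(nat, 'a) automaton" where
    "A = \<lparr> states = {..<d}, initial = 0, trans_map = (\<lambda>s x. (s * 2 + x) mod d),
           outputs = \<Omega>, output_map = a \<rparr>"
  have "k_automaton 2 A"
    using d assms by (auto simp: k_automaton_def A_def)
  moreover have "foldl (\<lambda>s x. (s * 2 + x) mod d) (v mod d) w = foldl (\<lambda>v x. v * 2 + x) v w mod d" for v w
  proof (induction w arbitrary: v)
    case (Cons x w)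
    have "(v mod d * 2 + x) mod d = (v * 2 + x) mod d"
      by (metis mod_add_left_eq mod_mult_left_eq)
    with Cons show ?case by simp
  qed simp
  from this[of 0] have "run A (initial A) (base_rep 2 n) = n mod d" for n
    by (simp add: A_def run_def base_rep_value)
  then have "generates 2 A a"
    unfolding generates_def by (simp add: A_def a_mod)
  moreover have "outputs A = \<Omega>" by (simp add: A_def)
  ultimately have "k_automatic 2 \<Omega> a" using assms by (intro k_automaticI)
  then show ?thesis by (auto simp: automatic_def)
qed

section \<open>Floors of polynomials modulo m\<close>

lemma floor_mod_irrational_poly_separates:
  fixes P :: "real poly" and m :: int and K i j :: nat
  assumes P: "degree P \<ge> 1" "lead_coeff P \<notin> \<rat>" and m: "m \<ge> 2" and K: "K \<ge> 1" and ij: "i < j"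
  shows "\<exists>n. \<lfloor>of_int m * poly P (real (K * n + i))\<rfloor> mod m \<noteq> \<lfloor>of_int m * poly P (real (K * n + j))\<rfloor> mod m"
proof -
  define r :: real where "r = 1 / of_int m"
  have r: "0 < r" "r \<le> 1 / 2" using m by (auto simp: r_def divide_simps)
  define Q where "Q = pcompose P [:real i, real K:]"
  \<comment> \<open>Replacing \<open>n\<close> by \<open>n + (j - i) / K\<close> turns
    \<open>K * n + i\<close> into \<open>K * n + j\<close>, so \<open>Q + D\<close> gives the values
    of \<open>P\<close> at \<open>K * n + j\<close>.\<close>
  define D where "D = pcompose Q [:(real j - real i) / real K, 1:] - Q"
  have Q_deg: "degree Q = degree P" using K by (simp add: Q_def degree_pcompose)
  have "lead_coeff Q = real K ^ degree P * lead_coeff P"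
    using K unfolding Q_def by (subst lead_coeff_comp) auto
  then have Q_irr: "lead_coeff Q \<notin> \<rat>" using irrational_mult[of "real K ^ degree P"] P K by simp
  obtain e where e: "degree Q = Suc e" using Q_deg P by (metis One_nat_def Suc_le_D)
  note D = poly_shift_diff[OF e, of "(real j - real i) / real K", folded D_def]
  have D_irr: "coeff D e \<notin> \<rat>"
    unfolding D(2) using Q_irr ij K by (intro irrational_mult) auto
  then have "coeff D e \<noteq> 0" by auto
  then have D_deg: "degree D = e" using D(1) le_degree[of D e] by simp
  have Q_eval: "poly P (real (K * n + i)) = poly Q (real n)" for n
    by (simp add: Q_def poly_pcompose algebra_simps)
  have D_eval: "poly P (real (K * n + j)) = poly Q (real n) + poly D (real n)" for n
  proof -
    have "real i + ((real j - real i) / real K + real n) * real K = real (K * n + j)"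
      using K by (simp add: field_simps)
    then show ?thesis by (simp add: D_def Q_def poly_pcompose mult.commute add.commute)
  qed
  have sep: ?thesis
    if "of_int l \<le> poly Q (real n)" "poly Q (real n) < of_int l + r"
      and "of_int k + r \<le> poly Q (real n) + poly D (real n)" "poly Q (real n) + poly D (real n) < of_int k + 1"
    for n and k l :: int
  proof -
    have "\<lfloor>of_int m * poly P (real (K * n + i))\<rfloor> mod m = 0"
      unfolding Q_eval using that m by (intro floor_mod_eq_0[of _ l]) (auto simp: r_def)
    moreover have "\<lfloor>of_int m * poly P (real (K * n + j))\<rfloor> mod m \<noteq> 0"
      unfolding D_eval using that m by (intro floor_mod_neq_0[of _ k]) (auto simp: r_def)
    ultimately show ?thesis by metis
  qed
  show ?thesis
  proof (cases "e = 0")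
    case False
    \<comment> \<open>Modulo 1, \<open>Q(n)\<close> lies in \<open>(r/4, 3r/4)\<close> and
      \<open>Q(n) + D(n)\<close> within \<open>r/2\<close> of \<open>1/2 + r/2\<close>, hence in
      \<open>(1/2, 1/2 + r)\<close>, inside \<open>[r, 1)\<close> as
      \<open>r \<le> 1/2\<close>.\<close>
    then obtain n and k l :: int where n: "\<bar>poly D (real n) - 1 / 2 - of_int k\<bar> < r / 4"
        "\<bar>poly Q (real n) - r / 2 - of_int l\<bar> < r / 4"
      using poly_pair_dense_mod_1[of D Q "r / 4" "1 / 2" "r / 2"] D_irr D_deg Q_irr e r by auto
    show ?thesis
      by (rule sep[of l n "l + k"], unfold of_int_add) (use n r in linarith)+
  next
    case True
    define \<alpha> where "\<alpha> = lead_coeff Q"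
    have "\<alpha> \<noteq> 0" using Q_irr by (auto simp: \<alpha>_def)
    have dense: "\<exists>n (l::int). \<bar>poly Q (real n) - x - of_int l\<bar> < \<delta>" if "\<delta> > 0" for x \<delta>
      \<comment> \<open>Only one coordinate matters here; \<open>\<alpha> n\<^sup>2\<close> is a dummy second one.\<close>
      using poly_pair_dense_mod_1[of Q "monom \<alpha> 2" \<delta> x 0] Q_irr e True that \<open>\<alpha> \<noteq> 0\<close>
      by (auto simp: degree_monom_eq \<alpha>_def)
    have D_const: "poly D x = coeff D 0" for x
      using D_deg True by (auto elim!: degree_eq_zeroE)
    define t where "t = frac (coeff D 0)"
    define z where "z = \<lfloor>coeff D 0\<rfloor>"
    have zt: "coeff D 0 = of_int z + t" by (simp add: t_def z_def frac_def)
    have "coeff D 0 \<notin> \<int>" using D_irr True Ints_subset_Rats by auto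
    then have t: "0 < t" "t < 1" by (auto simp: t_def frac_gt_0_iff frac_lt_1)
    show ?thesis
    proof (cases "t \<le> 1 / 2")
      case True
      \<comment> \<open>\<open>Q(n)\<close> is placed in \<open>(r - \<eta>, r)\<close> modulo 1:
        adding \<open>t \<ge> \<eta>\<close> carries it past \<open>r\<close>, and
        \<open>r + t \<le> 1\<close> keeps it below 1.\<close>
      define \<eta> where "\<eta> = min t r"
      have \<eta>: "0 < \<eta>" "\<eta> \<le> t" "\<eta> \<le> r" using t r by (auto simp: \<eta>_def)
      obtain n and l :: int where n: "\<bar>poly Q (real n) - (r - \<eta> / 2) - of_int l\<bar> < \<eta> / 2"
        using dense[of "\<eta> / 2" "r - \<eta> / 2"] \<eta> by auto
      show ?thesis
        by (rule sep[of l n "l + z"], unfold of_int_add D_const zt) (use n r \<eta> t True in linarith)+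
    next
      case False
      \<comment> \<open>\<open>Q(n)\<close> is placed in \<open>(0, \<eta>)\<close> modulo 1: adding
        \<open>t > 1/2\<close> carries it past \<open>r\<close>, and
        \<open>\<eta> \<le> 1 - t\<close> keeps it below 1.\<close>
      define \<eta> where "\<eta> = min (1 - t) r"
      have \<eta>: "0 < \<eta>" "\<eta> \<le> 1 - t" "\<eta> \<le> r" using t r by (auto simp: \<eta>_def)
      obtain n and l :: int where n: "\<bar>poly Q (real n) - \<eta> / 2 - of_int l\<bar> < \<eta> / 2"
        using dense[of "\<eta> / 2" "\<eta> / 2"] \<eta> by auto
      show ?thesis
        by (rule sep[of l n "l + z"], unfold of_int_add D_const zt) (use n r \<eta> t False in linarith)+
    qed
  qed
qed

lemma floor_mod_add_mult:
  fixes y :: real and m z :: int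
  shows "\<lfloor>of_int m * (y + of_int z)\<rfloor> mod m = \<lfloor>of_int m * y\<rfloor> mod m"
proof -
  have "\<lfloor>of_int m * (y + of_int z)\<rfloor> = \<lfloor>of_int m * y + of_int (m * z)\<rfloor>"
    by (simp add: algebra_simps)
  also have "\<dots> = \<lfloor>of_int m * y\<rfloor> + m * z" by (rule floor_add_int[symmetric])
  finally show ?thesis by simp
qed

text \<open>The constant term may be irrational: it cancels in \<open>q(n + M) - q(n)\<close>, so it
  is split off first.\<close>

lemma floor_mod_rational_poly_periodic:
  fixes q :: "real poly" and m :: int
  assumes "\<And>i. i \<ge> 1 \<Longrightarrow> coeff q i \<in> \<rat>"
  shows "periodic (\<lambda>n. \<lfloor>of_int m * poly q (real n)\<rfloor> mod m)"
proof -
  have "coeff (q - [:coeff q 0:]) i \<in> \<rat>" for i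
    using assms[of i] by (cases i) auto
  then obtain M :: nat where M: "M \<ge> 1"
    "\<And>n. \<exists>z::int. poly (q - [:coeff q 0:]) (real (n + M)) = poly (q - [:coeff q 0:]) (real n) + of_int z"
    using rational_poly_periodic_mod_1 by metis
  have "\<lfloor>of_int m * poly q (real (n + M))\<rfloor> mod m = \<lfloor>of_int m * poly q (real n)\<rfloor> mod m" for n
  proof -
    obtain z :: int where "poly q (real (n + M)) = poly q (real n) + of_int z"
      using M(2)[of n] by auto
    then show ?thesis by (simp only: floor_mod_add_mult)
  qed
  with M(1) show ?thesis unfolding periodic_def by (intro exI[of _ M]) auto
qed

lemma floor_mod_irrational_poly_not_automatic:
  fixes q :: "real poly" and m :: int
  assumes m: "m \<ge> 2" and i0: "i0 \<ge> 1" "coeff q i0 \<notin> \<rat>"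
  shows "\<not> automatic \<Omega> (\<lambda>n. \<lfloor>of_int m * poly q (real n)\<rfloor> mod m)"
proof
  define a where "a n = \<lfloor>of_int m * poly q (real n)\<rfloor> mod m" for n :: nat
  assume "automatic \<Omega> (\<lambda>n. \<lfloor>of_int m * poly q (real n)\<rfloor> mod m)"
  then obtain k where k: "k \<ge> 2" "k_automatic k \<Omega> a"
    by (auto simp: automatic_def a_def[abs_def])
  define E where "E = {i. i \<ge> 1 \<and> coeff q i \<notin> \<rat>}"
  have "i \<le> degree q" if "coeff q i \<notin> \<rat>" for i
    using that by (intro le_degree) auto
  then have "finite E" by (intro finite_subset[of E "{..degree q}"]) (auto simp: E_def)
  moreover have "E \<noteq> {}" using i0 by (auto simp: E_def)
  moreover define e where "e = Max E"
  ultimately have e: "e \<in> E" "\<And>i. i \<in> E \<Longrightarrow> i \<le> e" by (auto simp: e_def)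
  then have e1: "e \<ge> 1" "coeff q e \<notin> \<rat>" by (auto simp: E_def)
  \<comment> \<open>\<open>s\<close> keeps the constant term too, so \<open>q - s\<close> has
    rational coefficients and vanishes at 0.\<close>
  define s where "s = poly_cutoff (Suc e) q"
  have s_coeff: "coeff s i = (if i \<le> e then coeff q i else 0)" for i
    by (simp add: s_def coeff_poly_cutoff less_Suc_eq_le)
  have "coeff q e \<noteq> 0" using e1 by auto
  then have s_deg: "degree s = e"
    by (intro antisym degree_le le_degree) (auto simp: s_coeff)
  have "coeff (q - s) i \<in> \<rat>" for i
    using e(2)[of i] e1 by (cases "coeff q i \<in> \<rat>"; cases i) (auto simp: s_coeff E_def)
  then obtain M :: nat where M: "M \<ge> 1"
    "\<And>n. \<exists>z::int. poly (q - s) (real (n + M)) = poly (q - s) (real n) + of_int z"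
    using rational_poly_periodic_mod_1 by metis
  \<comment> \<open>\<open>q - s\<close> starts at 0 and changes by an integer from each multiple of
    \<open>M\<close> to the next.\<close>
  have int_part: "\<exists>z::int. poly (q - s) (real (M * n)) = of_int z" for n
  proof (induction n)
    case 0
    have "poly (q - s) 0 = of_int 0" by (simp add: poly_0_coeff_0 s_coeff)
    then show ?case by (metis mult_zero_right of_nat_0)
  next
    case (Suc n)
    then obtain z w :: int where "poly (q - s) (real (M * n)) = of_int z"
      "poly (q - s) (real (M * n + M)) = poly (q - s) (real (M * n)) + of_int w"
      using M(2)[of "M * n"] by blast
    then have "poly (q - s) (real (M * Suc n)) = of_int (z + w)" by (simp add: add.commute)
    then show ?case by blast
  qed
  define P where "P = pcompose s [:0, real M:]"
  have P_deg: "degree P = e" using M(1) by (simp add: P_def degree_pcompose s_deg)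
  have "lead_coeff P = real M ^ e * coeff q e"
    using M(1) unfolding P_def by (subst lead_coeff_comp) (auto simp: s_deg s_coeff)
  then have P_irr: "lead_coeff P \<notin> \<rat>" using irrational_mult[of "real M ^ e"] e1 M(1) by simp
  have a_P: "a (M * n) = \<lfloor>of_int m * poly P (real n)\<rfloor> mod m" for n
  proof -
    obtain z :: int where "poly (q - s) (real (M * n)) = of_int z" using int_part by blast
    then have "poly q (real (M * n)) = poly P (real n) + of_int z"
      by (simp add: P_def poly_pcompose algebra_simps)
    then show ?thesis unfolding a_def by (simp only: floor_mod_add_mult)
  qed
  obtain K i j where K: "K \<ge> 1" "i < j" and coll: "\<And>n. a (M * (K * n + i)) = a (M * (K * n + j))"
    using k_automatic_collision[OF k M(1)] by blast
  from floor_mod_irrational_poly_separates[OF _ P_irr m K] P_deg e1(1) coll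
  show False unfolding a_P by blast
qed

theorem corollary2p3:
  fixes p :: "real poly" and m :: int
  assumes "m \<ge> 2"
  shows "automatic {0..<m} (\<lambda>n. \<lfloor>poly p (real n)\<rfloor> mod m) \<longleftrightarrow>
         periodic (\<lambda>n. \<lfloor>poly p (real n)\<rfloor> mod m)"
proof
  assume "periodic (\<lambda>n. \<lfloor>poly p (real n)\<rfloor> mod m)"
  then show "automatic {0..<m} (\<lambda>n. \<lfloor>poly p (real n)\<rfloor> mod m)"
    using assms by (intro periodic_imp_automatic) auto
next
  assume automatic: "automatic {0..<m} (\<lambda>n. \<lfloor>poly p (real n)\<rfloor> mod m)"
  define q where "q = smult (1 / of_int m) p"
  have p: "poly p x = of_int m * poly q x" for x using assms by (simp add: q_def)
  \<comment> \<open>If some nonconstant coefficient of \<open>q\<close> were irrational, the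
    sequence would not be automatic; so all are rational and the sequence is periodic.\<close>
  show "periodic (\<lambda>n. \<lfloor>poly p (real n)\<rfloor> mod m)"
    using automatic floor_mod_rational_poly_periodic[of q m]
      floor_mod_irrational_poly_not_automatic[OF assms, of _ q]
    unfolding p by blast
qed

end
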